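(* Let $d$ be a positive integer and $1 > \delta > 0$. There is a positive constant $\lambda = \lambda (\delta, d)$, depending only on $\delta$ and $d$, such that for any finite family $\mathcal{F}$ of convex sets in $\mathbb{R}^d$ of diameter one each, there is a set $K\subset\mathbb{R}^d$ of diameter at least $1-\delta$ such that $K \subset \operatorname{conv} \left(\bigcup A\right)$ for at least $\lambda \binom{|\mathcal{F}|}{2d}$ subsets $A \subset \mathcal{F}$ of cardinality $2d$. Moreover, $\lambda$ can be chosen with $\lambda(\delta,d) = \Omega_d( \delta ^{d(d-1)})$.
   Context: The diameter of a set $X\subset\mathbb{R}^d$ is the supremum of Euclidean distances between two of its points. $\bigcup A$ denotes the union of all the sets belonging to $A$, and $\operatorname{conv}$ denotes convex hull. $g(d,\delta)=\Omega_d(f(d,\delta))$ means that for every fixed $d$ there are constants $a_d,\delta_d>0$ depending only on $d$ such that $g(d,\delta)\ge a_d f(d,\delta)$ for all $0<\delta<\delta_d$. *)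

theory Defs
  imports "HOL-Analysis.Analysis"
begin

end

theory Submission
  imports Defs
begin

text \<open>
  Choose in every member of the family a segment of length close to one.  Two directions at angle
  of order \<open>sqrt \<delta>\<close> are indistinguishable up to a factor \<open>1 - \<delta>\<close> in length, so by pigeonhole a
  fraction of order \<open>\<delta> powr ((d - 1) / 2)\<close> of the segments can be shortened to segments \<open>[p, q]\<close> with
  \<open>(q - p) \<bullet> v = 1 - \<delta>\<close> for one unit vector \<open>v\<close>.  The pairs \<open>(p, q)\<close> lie in an affine space of
  dimension \<open>2 * d - 1\<close>, so by the first selection lemma some \<open>(p', q')\<close> of this space lies in the hull
  of a positive fraction of the \<open>2 * d\<close>-tuples of pairs; \<open>K = {p', q'}\<close> works for each of
  these tuples.  Small families, where the pigeonhole step says nothing, are handled by taking for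
  \<open>K\<close> a member of the family.
\<close>

section \<open>Colourful Caratheodory theorem\<close>

text \<open>A supporting hyperplane cuts out a face of the hull, and a face of the hull of a finite
  set is spanned by the points of the set in that face.\<close>

lemma convex_hull_Int_supporting_hyperplane:
  fixes S :: "'a::euclidean_space set"
  assumes "finite S" "y \<in> convex hull S" "a \<bullet> y = b" "\<And>x. x \<in> S \<Longrightarrow> a \<bullet> x \<ge> b"
  shows "y \<in> convex hull (S \<inter> {x. a \<bullet> x = b})"
proof -
  have "convex hull S \<subseteq> {x. a \<bullet> x \<ge> b}"
    using assms(4) by (intro hull_minimal) (auto simp: convex_halfspace_ge)
  then have "convex hull S \<inter> {x. a \<bullet> x = b} face_of convex hull S"
    by (intro face_of_Int_supporting_hyperplane_ge) auto
  then obtain S' where S': "S' \<subseteq> S" "convex hull S \<inter> {x. a \<bullet> x = b} = convex hull S'"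
    using face_of_convex_hull_subset assms(1) finite_imp_compact by metis
  then have "S' \<subseteq> S \<inter> {x. a \<bullet> x = b}"
    using hull_subset[of S' convex] by blast
  then show ?thesis
    using S'(2) assms(2,3) hull_mono by blast
qed

text \<open>Barany's argument: among all rainbow choices take one whose hull is nearest to
  \<open>z\<close>. If the hull misses \<open>z\<close>, a proper subset of the colours already
  spans the nearest point, so an idle colour can be exchanged to bring the hull closer. Working
  inside \<open>H\<close> ties the number of colours to \<open>aff_dim H\<close> instead of the
  ambient dimension.\<close>

theorem colourful_Caratheodory:
  fixes G :: "'k \<Rightarrow> 'a::euclidean_space set"
  assumes "finite K" and fin: "\<And>k. k \<in> K \<Longrightarrow> finite (G k)"
    and zG: "\<And>k. k \<in> K \<Longrightarrow> z \<in> convex hull (G k)"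
    and H: "affine H" "\<And>k. k \<in> K \<Longrightarrow> G k \<subseteq> H" "z \<in> H" "aff_dim H < int (card K)"
  shows "\<exists>s. (\<forall>k\<in>K. s k \<in> G k) \<and> z \<in> convex hull (s ` K)"
proof -
  have Kne: "K \<noteq> {}"
    using H(3,4) aff_dim_negative_iff[of H] by force
  define S where "S = Pi\<^sub>E K G"
  define dst where "dst = (\<lambda>s. infdist z (convex hull (s ` K)))"
  have "\<forall>k\<in>K. G k \<noteq> {}"
    using zG by force
  then have "finite S" "S \<noteq> {}"
    using \<open>finite K\<close> fin by (auto simp: S_def PiE_eq_empty_iff intro!: finite_PiE)
  then obtain s where s: "s \<in> S" and min: "\<And>t. t \<in> S \<Longrightarrow> dst s \<le> dst t"
    using ex_is_arg_min_if_finite[of S dst] by (auto simp: is_arg_min_linorder)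
  have sG: "\<And>k. k \<in> K \<Longrightarrow> s k \<in> G k"
    using s by (auto simp: S_def)
  define T where "T = convex hull (s ` K)"
  have cT: "compact T" "closed T" "convex T" "T \<noteq> {}"
    using \<open>finite K\<close> Kne
    by (auto simp: T_def finite_imp_compact_convex_hull compact_imp_closed)
  have "z \<in> T"
  proof (rule ccontr)
    assume "z \<notin> T"
    define y where "y = closest_point T z"
    define w where "w = y - z"
    have yT: "y \<in> T"
      by (simp add: y_def cT closest_point_in_set)
    then have "w \<noteq> 0"
      using \<open>z \<notin> T\<close> by (auto simp: w_def)
    have dots: "dst s = dist z y"
      unfolding dst_def y_def T_def[symmetric]
      using cT by (metis infdist_eq_setdist setdist_closest_point)
    have "w \<bullet> x \<ge> w \<bullet> y" if "x \<in> T" for x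
      using closest_point_dot[OF cT(3,2) that, of z]
      by (simp add: w_def y_def inner_diff_left inner_diff_right)
    then have "y \<in> convex hull (s ` K \<inter> {x. w \<bullet> x = w \<bullet> y})"
      using yT \<open>finite K\<close>
      by (intro convex_hull_Int_supporting_hyperplane) (auto simp: T_def hull_inc)
    then obtain W where W: "W \<subseteq> s ` K \<inter> {x. w \<bullet> x = w \<bullet> y}" "y \<in> convex hull W"
        "int (card W) \<le> aff_dim (s ` K \<inter> {x. w \<bullet> x = w \<bullet> y}) + 1"
      unfolding caratheodory_aff_dim[of "s ` K \<inter> _"] by blast
    have wz: "w \<bullet> z < w \<bullet> y"
      using inner_gt_zero_iff[of w] \<open>w \<noteq> 0\<close> by (simp add: w_def inner_diff_right)
    \<comment> \<open>The hyperplane through \<open>y\<close> misses \<open>z\<close>, which lies in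
      \<open>H\<close>, so it cuts the dimension by one. Caratheodory then needs fewer than
      \<open>card K\<close> points, and some colour \<open>k\<close> is idle.\<close>
    have "aff_dim (s ` K \<inter> {x. w \<bullet> x = w \<bullet> y}) \<le> aff_dim (H \<inter> {x. w \<bullet> x = w \<bullet> y})"
      using sG H(2) by (intro aff_dim_subset) blast
    also have "\<dots> \<le> aff_dim H - 1"
    proof -
      have "aff_dim H \<ge> 0" "\<not> H \<subseteq> {x. w \<bullet> x = w \<bullet> y}"
        using H(3) wz aff_dim_negative_iff[of H] by (force simp: not_less[symmetric])+
      then show ?thesis
        by (simp add: aff_dim_affine_Int_hyperplane[OF H(1)])
    qed
    finally have "card W < card K"
      using W(3) H(4) by linarith
    from W(1) obtain K' where K': "K' \<subseteq> K" "inj_on s K'" "W = s ` K'"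
      using subset_image_inj[of W s K] by auto
    then have "K' \<noteq> K"
      using \<open>card W < card K\<close> by (auto simp: card_image)
    then obtain k where k: "k \<in> K" "k \<notin> K'"
      using K' by blast
    obtain g where g: "g \<in> G k" "w \<bullet> g \<le> w \<bullet> z"
    proof (rule ccontr)
      assume "\<not> thesis"
      then have "G k \<subseteq> {x. w \<bullet> x > w \<bullet> z}"
        using that by force
      then have "convex hull (G k) \<subseteq> {x. w \<bullet> x > w \<bullet> z}"
        by (intro hull_minimal convex_halfspace_gt)
      then show False
        using zG[OF k(1)] by auto
    qed
    define s' where "s' = s(k := g)"
    have s'S: "s' \<in> S"
      using s g k unfolding S_def s'_def by (metis PiE_fun_upd insert_absorb)
    have "s ` K' \<subseteq> s' ` K"
      using K' k by (force simp: s'_def)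
    then have "y \<in> convex hull (s' ` K)"
      using W(2) K'(3) hull_mono by blast
    moreover have "g \<in> convex hull (s' ` K)"
      using k by (intro hull_inc) (auto simp: s'_def intro!: image_eqI[of _ _ k])
    ultimately have seg: "y + u *\<^sub>R (g - y) \<in> convex hull (s' ` K)" if "0 < u" "u \<le> 1" for u
      using convexD_alt[OF convex_convex_hull, of y _ g u] that by (simp add: algebra_simps)
    \<comment> \<open>This inner product is positive, so moving from \<open>y\<close> towards
      \<open>g\<close> at first decreases the distance to \<open>z\<close>.\<close>
    have "(z - y) \<bullet> (g - y) = w \<bullet> y - w \<bullet> g"
      by (simp add: w_def algebra_simps)
    then obtain u where u: "u > 0" "u \<le> 1" "dist (y + u *\<^sub>R (g - y)) z < dist y z"
      using closer_point_lemma[of z y g] g wz by force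
    have "dst s' \<le> dist z (y + u *\<^sub>R (g - y))"
      unfolding dst_def using seg u by (intro infdist_le) auto
    then show False
      using u(3) min[OF s'S] dots by (simp add: dist_commute)
  qed
  then show ?thesis
    using sG by (auto simp: T_def)
qed

section \<open>Centrepoints, Tverberg partitions and the first selection lemma\<close>

text \<open>By Helly: \<open>DIM('a) + 1\<close> complements, each smaller than a fraction 1 /
  (\<open>DIM('a) + 1\<close>) of \<open>I\<close>, cannot cover \<open>I\<close>, so the
  corresponding hulls share a point. Index sets rather than point sets make coinciding points count
  with multiplicity.\<close>

lemma centrepoint:
  fixes x :: "'i \<Rightarrow> 'a::euclidean_space"
  assumes "finite I" "I \<noteq> {}"
  obtains c where "\<And>J. J \<subseteq> I \<Longrightarrow> (DIM('a) + 1) * card (I - J) < card I \<Longrightarrow> c \<in> convex hull (x ` J)"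
proof -
  define \<J> where "\<J> = {J. J \<subseteq> I \<and> (DIM('a) + 1) * card (I - J) < card I}"
  define \<F> where "\<F> = (\<lambda>J. convex hull (x ` J)) ` \<J>"
  have "finite \<F>"
    using assms by (auto simp: \<F>_def \<J>_def)
  have small: "\<Inter>t \<noteq> {}" if t: "t \<subseteq> \<F>" "card t \<le> DIM('a) + 1" for t
  proof -
    \<comment> \<open>Helly counts distinct hulls, so one index set is fixed for each hull in
      \<open>t\<close>.\<close>
    obtain \<U> where U: "\<U> \<subseteq> \<J>" "inj_on (\<lambda>J. convex hull (x ` J)) \<U>"
        "t = (\<lambda>J. convex hull (x ` J)) ` \<U>"
      using t(1) subset_image_inj[of t "\<lambda>J. convex hull (x ` J)" \<J>] unfolding \<F>_def by auto
    then have cU: "card \<U> \<le> DIM('a) + 1"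
      using t(2) by (simp add: card_image)
    have "finite \<J>"
      using assms by (auto simp: \<J>_def)
    then have finU: "finite \<U>"
      using U(1) finite_subset by blast
    have "(\<Union>J\<in>\<U>. I - J) \<noteq> I"
    proof (cases "\<U> = {}")
      case True
      then show ?thesis using assms by auto
    next
      case False
      have "(DIM('a) + 1) * card (\<Union>J\<in>\<U>. I - J) \<le> (\<Sum>J\<in>\<U>. (DIM('a) + 1) * card (I - J))"
        using card_UN_le[OF finU, of "\<lambda>J. I - J"]
        by (metis mult_le_mono2 sum_distrib_left)
      also have "\<dots> < (\<Sum>J\<in>\<U>. card I)"
        using U(1) False finU by (intro sum_strict_mono) (auto simp: \<J>_def)
      also have "\<dots> \<le> (DIM('a) + 1) * card I"
        using mult_right_mono[OF cU, of "card I"] by simp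
      finally show ?thesis
        by auto
    qed
    then obtain i where "i \<in> I" "\<forall>J\<in>\<U>. i \<in> J"
      by blast
    then have "\<forall>T\<in>t. x i \<in> T"
      using U(3) by (auto intro: hull_inc)
    then show ?thesis
      by blast
  qed
  have "\<Inter>\<F> \<noteq> {}"
  proof (cases "card \<F> \<ge> DIM('a) + 1")
    case True
    then show ?thesis
    proof (rule Helly)
      show "\<forall>S\<in>\<F>. convex S"
        by (simp add: \<F>_def)
    qed (use small in auto)
  next
    case False
    then show ?thesis
      using small by auto
  qed
  then obtain c where "c \<in> \<Inter>\<F>"
    by blast
  then have "c \<in> convex hull (x ` J)"
    if "J \<subseteq> I" "(DIM('a) + 1) * card (I - J) < card I" for J
    using that unfolding \<F>_def \<J>_def by blast
  with that show thesis
    by blast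
qed

text \<open>Remove Caratheodory simplices around a centrepoint one after the other: each removal
  costs at most \<open>DIM('a) + 1\<close> points, so the centrepoint stays in the hull of the rest.\<close>
lemma weak_Tverberg:
  fixes x :: "'i \<Rightarrow> 'a::euclidean_space"
  assumes "finite I" "I \<noteq> {}" "r * (DIM('a) + 1)\<^sup>2 \<le> card I"
  shows "\<exists>G c. (\<forall>j<r. G j \<subseteq> I \<and> c \<in> convex hull (x ` G j)) \<and> disjoint_family_on G {..<r}"
proof -
  obtain c where c: "\<And>J. J \<subseteq> I \<Longrightarrow> (DIM('a) + 1) * card (I - J) < card I \<Longrightarrow> c \<in> convex hull (x ` J)"
    using centrepoint[OF assms(1,2), of x] by blast
  have "\<exists>G. (\<forall>j<m. G j \<subseteq> I \<and> c \<in> convex hull (x ` G j) \<and> card (G j) \<le> DIM('a) + 1)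
      \<and> disjoint_family_on G {..<m}" if "m \<le> r" for m
    using that
  proof (induction m)
    case 0
    then show ?case by (auto simp: disjoint_family_on_def)
  next
    case (Suc m)
    then obtain G where G: "\<And>j. j < m \<Longrightarrow> G j \<subseteq> I" "\<And>j. j < m \<Longrightarrow> c \<in> convex hull (x ` G j)"
      "\<And>j. j < m \<Longrightarrow> card (G j) \<le> DIM('a) + 1" "disjoint_family_on G {..<m}"
      by auto
    define J where "J = I - (\<Union>j<m. G j)"
    \<comment> \<open>The removed points number at most \<open>m * (DIM('a) + 1)\<close>, and the
      centrepoint property costs another factor \<open>DIM('a) + 1\<close>; hence the square in the
      hypothesis.\<close>
    have "card (I - J) \<le> card (\<Union>j<m. G j)"
      using G(1) \<open>finite I\<close> by (intro card_mono) (auto simp: J_def intro: finite_subset)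
    also have "\<dots> \<le> (\<Sum>j<m. card (G j))"
      by (rule card_UN_le) simp
    also have "\<dots> \<le> m * (DIM('a) + 1)"
      using sum_bounded_above[of "{..<m}" "\<lambda>j. card (G j)" "DIM('a) + 1"] G(3) by simp
    finally have "(DIM('a) + 1) * card (I - J) \<le> (DIM('a) + 1) * (m * (DIM('a) + 1))"
      by (intro mult_left_mono) auto
    also have "\<dots> = m * (DIM('a) + 1)\<^sup>2"
      by (simp add: power2_eq_square algebra_simps)
    also have "\<dots> < Suc m * (DIM('a) + 1)\<^sup>2"
      by simp
    also have "\<dots> \<le> r * (DIM('a) + 1)\<^sup>2"
      using Suc.prems by (intro mult_right_mono) auto
    also have "\<dots> \<le> card I"
      by (rule assms)
    finally have "c \<in> convex hull (x ` J)"
      by (intro c) (auto simp: J_def)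
    then obtain W where W: "W \<subseteq> x ` J" "card W \<le> DIM('a) + 1" "c \<in> convex hull W"
      unfolding caratheodory[of "x ` J"] by blast
    then obtain U where U: "U \<subseteq> J" "inj_on x U" "W = x ` U"
      using subset_image_inj[of W x J] by auto
    have "disjoint_family_on (G(m := U)) {..<Suc m}"
      using G(4) U(1) by (fastforce simp: disjoint_family_on_def J_def less_Suc_eq)
    moreover have "\<forall>j<Suc m. (G(m := U)) j \<subseteq> I \<and> c \<in> convex hull (x ` (G(m := U)) j)
        \<and> card ((G(m := U)) j) \<le> DIM('a) + 1"
      using G W U by (auto simp: J_def less_Suc_eq card_image)
    ultimately show ?case
      by blast
  qed
  from this[of r] show ?thesis
    by auto
qed

text \<open>Any \<open>k\<close> of the \<open>r\<close> Tverberg classes are colour classes whose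
  hulls all contain \<open>c\<close>, so a transversal of them captures \<open>c\<close>. As the
  classes are disjoint, different choices of classes give different transversals.\<close>

theorem first_selection:
  fixes x :: "'i \<Rightarrow> 'a::euclidean_space"
  assumes "finite I" "I \<noteq> {}" "r * (DIM('a) + 1)\<^sup>2 \<le> card I"
    and H: "affine H" "x ` I \<subseteq> H" "aff_dim H < int k"
  shows "\<exists>c. r choose k \<le> card {A. A \<subseteq> I \<and> card A = k \<and> c \<in> convex hull (x ` A)}"
proof -
  obtain G c where G: "\<And>j. j < r \<Longrightarrow> G j \<subseteq> I" "\<And>j. j < r \<Longrightarrow> c \<in> convex hull (x ` G j)"
    "disjoint_family_on G {..<r}"
    using weak_Tverberg[OF assms(1-3), of x] by auto
  have ex: "\<exists>t. (\<forall>j\<in>R. t j \<in> G j) \<and> c \<in> convex hull (x ` t ` R)"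
    if R: "R \<subseteq> {..<r}" "card R = k" for R
  proof -
    \<comment> \<open>At least one class is needed to place \<open>c\<close> in
      \<open>H\<close>.\<close>
    have "k \<noteq> 0"
      using H assms(2) aff_dim_negative_iff[of H] by force
    then obtain j where "j \<in> R"
      using R by fastforce
    then have "c \<in> convex hull (x ` G j)" "x ` G j \<subseteq> H"
      using R G H(2) by blast+
    then have "c \<in> H"
      using hull_minimal[of "x ` G j" H convex] H(1) affine_imp_convex by blast
    have xG: "c \<in> convex hull (x ` G l)" "x ` G l \<subseteq> H" "finite (x ` G l)" if "l \<in> R" for l
      using R(1) that G H(2) assms(1) by (blast intro: finite_subset)+
    have "finite R"
      using R(1) finite_subset by blast
    with xG have "\<exists>s. (\<forall>j\<in>R. s j \<in> x ` G j) \<and> c \<in> convex hull (s ` R)"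
      using H(1,3) R(2) \<open>c \<in> H\<close> by (intro colourful_Caratheodory[where H = H]) simp_all
    then obtain s where s: "\<forall>j\<in>R. s j \<in> x ` G j" "c \<in> convex hull (s ` R)"
      by blast
    then have "\<forall>j\<in>R. \<exists>i. i \<in> G j \<and> s j = x i"
      by blast
    then obtain t where t: "\<forall>j\<in>R. t j \<in> G j \<and> s j = x (t j)"
      by (rule bchoice[THEN exE])
    then have "s ` R = x ` t ` R"
      by (auto simp: image_image)
    then have "c \<in> convex hull (x ` t ` R)"
      using s(2) by simp
    then show ?thesis
      using t by blast
  qed
  have "\<forall>R. \<exists>t. R \<subseteq> {..<r} \<and> card R = k \<longrightarrow> (\<forall>j\<in>R. t j \<in> G j) \<and> c \<in> convex hull (x ` t ` R)"
    using ex by blast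
  then obtain t where t: "\<forall>R. R \<subseteq> {..<r} \<and> card R = k \<longrightarrow>
      (\<forall>j\<in>R. t R j \<in> G j) \<and> c \<in> convex hull (x ` t R ` R)"
    by (rule choice[THEN exE])
  define \<R> where "\<R> = {R. R \<subseteq> {..<r} \<and> card R = k}"
  have colour: "j = l" if "i \<in> G j" "i \<in> G l" "j < r" "l < r" for i j l
    using G(3) that by (auto simp: disjoint_family_on_def)
  have tG: "t R j \<in> G j" if "R \<in> \<R>" "j \<in> R" for R j
    using t that by (auto simp: \<R>_def)
  \<comment> \<open>A transversal meets exactly the classes from which it was chosen, so it
    determines \<open>R\<close>.\<close>
  have recover: "R = {j. j < r \<and> G j \<inter> t R ` R \<noteq> {}}" if R: "R \<in> \<R>" for R
  proof (intro set_eqI iffI)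
    fix j assume "j \<in> R"
    then show "j \<in> {j. j < r \<and> G j \<inter> t R ` R \<noteq> {}}"
      using tG[OF R] R by (auto simp: \<R>_def)
  next
    fix j assume "j \<in> {j. j < r \<and> G j \<inter> t R ` R \<noteq> {}}"
    then obtain l where l: "j < r" "l \<in> R" "t R l \<in> G j"
      by blast
    then have "j = l"
      using colour[of "t R l" j l] tG[OF R] R by (auto simp: \<R>_def)
    then show "j \<in> R"
      using l by simp
  qed
  have inj: "inj_on (\<lambda>R. t R ` R) \<R>"
  proof (rule inj_onI)
    fix R R' assume "R \<in> \<R>" "R' \<in> \<R>" "t R ` R = t R' ` R'"
    then show "R = R'"
      using recover[of R] recover[of R'] by simp
  qed
  have "t R ` R \<in> {A. A \<subseteq> I \<and> card A = k \<and> c \<in> convex hull (x ` A)}" if R: "R \<in> \<R>" for R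
  proof -
    have R': "R \<subseteq> {..<r}" "card R = k" "c \<in> convex hull (x ` t R ` R)"
      using R t by (auto simp: \<R>_def)
    have "inj_on (t R) R"
    proof (rule inj_onI)
      fix j l assume "j \<in> R" "l \<in> R" "t R j = t R l"
      then show "j = l"
        using colour[of "t R l" j l] tG[OF R, of j] tG[OF R, of l] R'(1) by auto
    qed
    moreover have "t R ` R \<subseteq> I"
      using R'(1) tG[OF R] G(1) by fastforce
    ultimately show ?thesis
      using R' by (simp add: card_image)
  qed
  then have "card \<R> \<le> card {A. A \<subseteq> I \<and> card A = k \<and> c \<in> convex hull (x ` A)}"
    using inj assms(1) by (intro card_inj_on_le[of "\<lambda>R. t R ` R"]) auto
  moreover have "card \<R> = r choose k"
    using n_subsets[of "{..<r}" k] by (simp add: \<R>_def)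
  ultimately show ?thesis
    by metis
qed

section \<open>Pigeonhole on directions and selection for parallel segments\<close>

lemma inner_sgn_ge:
  fixes a b :: "'a::real_inner"
  assumes "norm a \<ge> 1" "norm b \<ge> 1"
  shows "(1 - (norm (a - b))\<^sup>2 / 2) * norm a \<le> a \<bullet> sgn b"
proof -
  define t where "t = (norm (a - b))\<^sup>2"
  have "t = norm a ^ 2 + norm b ^ 2 - 2 * (a \<bullet> b)"
    by (simp add: t_def power2_norm_eq_inner inner_diff inner_commute)
  moreover have "(norm a - norm b)\<^sup>2 \<ge> 0"
    by simp
  ultimately have "norm a * norm b - t / 2 \<le> a \<bullet> b"
    unfolding power2_diff by linarith
  moreover have "1 * t \<le> (norm a * norm b) * t"
    using assms mult_mono[of 1 "norm a" 1 "norm b"] by (intro mult_right_mono) (auto simp: t_def)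
  ultimately have "(1 - t / 2) * norm a * norm b \<le> a \<bullet> b"
    by (simp add: algebra_simps)
  then have "(1 - t / 2) * norm a \<le> (a \<bullet> b) / norm b"
    using assms by (subst le_divide_eq) auto
  moreover have "a \<bullet> sgn b = (a \<bullet> b) / norm b"
    by (simp only: sgn_div_norm inner_scaleR_right divide_inverse mult.commute)
  ultimately show ?thesis
    by (simp only: t_def)
qed

text \<open>The class of a vector \<open>e\<close> records the index \<open>i\<close> of a largest coordinate and a cell of the
  grid of mesh \<open>1 / N\<close> containing \<open>e / e $ i\<close>.  This costs \<open>CARD('n) - 1\<close> grid coordinates, one
  less than a grid on the whole space; that is what makes the exponent in the theorem right.\<close>
lemma direction_pigeonhole:
  fixes e :: "'b \<Rightarrow> real ^ 'n::finite"
  assumes "finite F" "F \<noteq> {}" "\<And>C. C \<in> F \<Longrightarrow> e C \<noteq> 0" "N > 0"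
  obtains v F' where "norm v = 1" "F' \<subseteq> F"
    "card F \<le> card F' * (CARD('n) * (2 * N + 1) ^ (CARD('n) - 1))"
    "\<And>C. C \<in> F' \<Longrightarrow> (1 - real CARD('n) / (2 * (real N)\<^sup>2)) * norm (e C) \<le> \<bar>e C \<bullet> v\<bar>"
proof -
  have "\<exists>i. \<forall>j. \<bar>e C $ j\<bar> \<le> \<bar>e C $ i\<bar>" for C
    using ex_is_arg_min_if_finite[of "UNIV :: 'n set" "\<lambda>j. - \<bar>e C $ j\<bar>"]
    by (auto simp: is_arg_min_linorder)
  then obtain idx where idx: "\<And>C j. \<bar>e C $ j\<bar> \<le> \<bar>e C $ idx C\<bar>"
    by metis
  have nz: "e C $ idx C \<noteq> 0" if "C \<in> F" for C
  proof
    assume "e C $ idx C = 0"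
    then have "e C $ j = 0" for j
      using idx[of C j] by simp
    then show False
      using assms(3)[OF that] by (simp add: vec_eq_iff)
  qed
  \<comment> \<open>The pivot coordinate of \<open>w C\<close> is 1, so the norm is at least 1, as
    \<open>inner_sgn_ge\<close> demands. The sign of \<open>e C\<close> is lost: opposite vectors
    fall into the same class, hence the absolute value in the conclusion.\<close>
  define w where "w = (\<lambda>C. (1 / e C $ idx C) *\<^sub>R e C)"
  have w_le: "\<bar>w C $ j\<bar> \<le> 1" for C j
    using idx[of C j] by (simp add: w_def divide_le_eq_1)
  have w_idx: "w C $ idx C = 1" if "C \<in> F" for C
    using nz[OF that] by (simp add: w_def)
  have norm_w: "norm (w C) \<ge> 1" if "C \<in> F" for C
    using component_le_norm_cart[of "w C" "idx C"] w_idx[OF that] by simp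
  define key where "key = (\<lambda>C. (idx C, restrict (\<lambda>j. \<lfloor>N * w C $ j\<rfloor>) (UNIV - {idx C})))"
  define B where "B = (SIGMA i:(UNIV :: 'n set). PiE (UNIV - {i}) (\<lambda>_. {- int N..int N}))"
  \<comment> \<open>The value \<open>N\<close> occurs when the coordinate equals 1, so there are
    \<open>2 * N + 1\<close> cells, not \<open>2 * N\<close>.\<close>
  have "\<lfloor>N * w C $ j\<rfloor> \<in> {- int N..int N}" for C j
  proof -
    have "N * \<bar>w C $ j\<bar> \<le> N"
      using mult_left_mono[OF w_le[of C j], of "real N"] by simp
    then have "\<bar>N * w C $ j\<bar> \<le> N"
      by (simp add: abs_mult)
    then show ?thesis
      by (simp add: le_floor_iff floor_le_iff abs_le_iff)
  qed
  then have keyB: "key \<in> F \<rightarrow> B"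
    by (auto simp: key_def B_def)
  have finB: "finite B"
    unfolding B_def by (intro finite_SigmaI finite_PiE) auto
  have cardB: "card B = CARD('n) * (2 * N + 1) ^ (CARD('n) - 1)"
  proof -
    have "card B = (\<Sum>i\<in>(UNIV :: 'n set). card (PiE (UNIV - {i}) (\<lambda>_. {- int N..int N})))"
      unfolding B_def by (subst card_SigmaI) (auto intro: finite_PiE)
    also have "\<dots> = (\<Sum>i\<in>(UNIV :: 'n set). (2 * N + 1) ^ (CARD('n) - 1))"
    proof (rule sum.cong)
      fix i :: 'n
      have "card {- int N..int N} = 2 * N + 1"
        by simp
      then show "card (PiE (UNIV - {i}) (\<lambda>_. {- int N..int N})) = (2 * N + 1) ^ (CARD('n) - 1)"
        by (simp only: card_PiE prod_constant card_Diff_singleton finite_Diff finite_code UNIV_I finite)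
    qed simp
    finally show ?thesis
      by simp
  qed
  have "B \<noteq> {}"
    using keyB \<open>F \<noteq> {}\<close> by auto
  then obtain y where y: "card F \<le> card (key -` {y} \<inter> F) * card B"
    using pigeonhole_card[OF keyB \<open>finite F\<close> finB] by blast
  define F' where "F' = key -` {y} \<inter> F"
  have "card F > 0"
    using assms by (simp add: card_gt_0_iff)
  then have "F' \<noteq> {}"
    using y by (auto simp: F'_def)
  then obtain C0 where C0: "C0 \<in> F'"
    by blast
  have "(1 - real CARD('n) / (2 * (real N)\<^sup>2)) * norm (e C) \<le> \<bar>e C \<bullet> sgn (w C0)\<bar>"
    if C: "C \<in> F'" for C
  proof -
    have CF: "C \<in> F" "C0 \<in> F" "key C = key C0"
      using C C0 by (auto simp: F'_def)
    then have same: "idx C = idx C0"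
      by (simp add: key_def)
    have coord: "\<bar>w C $ j - w C0 $ j\<bar> \<le> 1 / N" for j
    proof (cases "j = idx C0")
      case True
      then show ?thesis
        using w_idx[OF CF(1)] w_idx[OF CF(2)] same by simp
    next
      case False
      have "snd (key C) j = snd (key C0) j"
        using CF by simp
      then have "\<lfloor>N * w C $ j\<rfloor> = \<lfloor>N * w C0 $ j\<rfloor>"
        using False same by (simp add: key_def)
      then have "\<bar>N * w C $ j - N * w C0 $ j\<bar> \<le> 1"
        by linarith
      then have "N * \<bar>w C $ j - w C0 $ j\<bar> \<le> 1"
        by (simp add: abs_mult flip: right_diff_distrib)
      then show ?thesis
        using \<open>N > 0\<close> by (simp add: field_simps)
    qed
    have "(norm (w C - w C0))\<^sup>2 = (\<Sum>j\<in>UNIV. (w C $ j - w C0 $ j)\<^sup>2)"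
      unfolding power2_norm_eq_inner by (simp add: inner_vec_def power2_eq_square)
    also have "\<dots> \<le> (\<Sum>j\<in>(UNIV :: 'n set). (1 / real N)\<^sup>2)"
    proof (rule sum_mono)
      fix j show "(w C $ j - w C0 $ j)\<^sup>2 \<le> (1 / real N)\<^sup>2"
        using power_mono[OF coord[of j], of 2] by simp
    qed
    finally have "(norm (w C - w C0))\<^sup>2 / 2 \<le> real CARD('n) / (2 * (real N)\<^sup>2)"
      by (simp add: power_divide)
    then have "(1 - real CARD('n) / (2 * (real N)\<^sup>2)) * norm (w C)
        \<le> (1 - (norm (w C - w C0))\<^sup>2 / 2) * norm (w C)"
      by (intro mult_right_mono) auto
    also have "\<dots> \<le> w C \<bullet> sgn (w C0)"
      using norm_w CF by (intro inner_sgn_ge) auto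
    also have "\<dots> \<le> \<bar>w C \<bullet> sgn (w C0)\<bar>"
      by simp
    \<comment> \<open>Multiplying by the modulus of the pivot coordinate undoes the
      rescaling.\<close>
    finally have "\<bar>e C $ idx C\<bar> * ((1 - real CARD('n) / (2 * (real N)\<^sup>2)) * norm (w C))
        \<le> \<bar>e C $ idx C\<bar> * \<bar>w C \<bullet> sgn (w C0)\<bar>"
      by (rule mult_left_mono) simp
    moreover have "norm (e C) = \<bar>e C $ idx C\<bar> * norm (w C)"
      using nz[OF CF(1)] by (simp add: w_def)
    moreover have "\<bar>e C \<bullet> sgn (w C0)\<bar> = \<bar>e C $ idx C\<bar> * \<bar>w C \<bullet> sgn (w C0)\<bar>"
      using nz[OF CF(1)] by (simp add: w_def abs_mult)
    ultimately show ?thesis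
      by (simp only: mult.left_commute)
  qed
  moreover have "norm (sgn (w C0)) = 1"
    using norm_w[of C0] C0 by (auto simp: norm_sgn F'_def)
  moreover have "F' \<subseteq> F" "card F \<le> card F' * (CARD('n) * (2 * N + 1) ^ (CARD('n) - 1))"
    using y unfolding F'_def cardB by blast+
  ultimately show thesis
    using that by blast
qed

text \<open>Points \<open>(p, q)\<close> with \<open>(q - p) \<bullet> v = l\<close> form a hyperplane of dimension \<open>2 * CARD('n) - 1\<close>,
  so the selection theorem for the pairs of end points needs only \<open>2 * CARD('n)\<close> colours.\<close>
lemma parallel_segments_selection:
  fixes F :: "(real ^ 'n::finite) set set"
  assumes "finite F" and r: "r * (2 * CARD('n) + 1)\<^sup>2 \<le> card F" "2 * CARD('n) \<le> r"
    and v: "norm v = 1" and "l > 0"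
    and conv: "\<And>C. C \<in> F \<Longrightarrow> convex C"
    and long: "\<And>C. C \<in> F \<Longrightarrow> \<exists>p\<in>C. \<exists>q\<in>C. l \<le> (q - p) \<bullet> v"
  shows "\<exists>K. bounded K \<and> diameter K \<ge> l \<and>
    r choose (2 * CARD('n)) \<le> card {A. A \<subseteq> F \<and> card A = 2 * CARD('n) \<and> K \<subseteq> convex hull (\<Union>A)}"
proof -
  have "\<exists>p q. p \<in> C \<and> q \<in> C \<and> (q - p) \<bullet> v = l" if C: "C \<in> F" for C
  proof -
    obtain p q where pq: "p \<in> C" "q \<in> C" "l \<le> (q - p) \<bullet> v"
      using long[OF C] by blast
    \<comment> \<open>Shortening makes the projection exactly \<open>l\<close>, so that all pairs of
      end points lie on one hyperplane.\<close>
    define t where "t = l / ((q - p) \<bullet> v)"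
    have t: "0 \<le> t" "t \<le> 1" "t * ((q - p) \<bullet> v) = l"
      using pq \<open>l > 0\<close> by (auto simp: t_def)
    have "(1 - t) *\<^sub>R p + t *\<^sub>R q \<in> C"
      using convexD_alt[OF conv[OF C] pq(1,2)] t by simp
    moreover have "((1 - t) *\<^sub>R p + t *\<^sub>R q - p) \<bullet> v = l"
      using t(3) by (simp add: algebra_simps)
    ultimately show ?thesis
      using pq by blast
  qed
  then obtain p q where pq: "\<And>C. C \<in> F \<Longrightarrow> p C \<in> C" "\<And>C. C \<in> F \<Longrightarrow> q C \<in> C"
      "\<And>C. C \<in> F \<Longrightarrow> (q C - p C) \<bullet> v = l"
    by metis
  define x where "x = (\<lambda>C. (p C, q C))"
  define H where "H = {z. (- v, v) \<bullet> z = l}"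
  have "v \<noteq> 0"
    using v by auto
  then have "aff_dim H = int (2 * CARD('n) - 1)"
    by (simp add: H_def zero_prod_def mult_2)
  moreover have "0 < CARD('n)"
    by simp
  ultimately have "aff_dim H < int (2 * CARD('n))"
    by linarith
  then have H: "affine H" "aff_dim H < int (2 * CARD('n))" "x ` F \<subseteq> H"
    using pq(3) affine_hyperplane[of "(- v, v)" l]
    by (auto simp: H_def x_def inner_diff_right inner_commute[of _ v])
  have "0 < card F"
  proof -
    have "0 < 2 * CARD('n)"
      by simp
    then have "0 < r"
      using r(2) by linarith
    then have "0 < r * (2 * CARD('n) + 1)\<^sup>2"
      by simp
    then show ?thesis
      using r(1) by linarith
  qed
  then have "F \<noteq> {}"
    by auto
  moreover have "r * (DIM((real ^ 'n) \<times> (real ^ 'n)) + 1)\<^sup>2 \<le> card F"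
    using r(1) by (simp add: mult_2)
  ultimately obtain c where c:
    "r choose (2 * CARD('n)) \<le> card {A. A \<subseteq> F \<and> card A = 2 * CARD('n) \<and> c \<in> convex hull (x ` A)}"
    using first_selection[OF \<open>finite F\<close> _ _ H(1,3,2)] by blast
  \<comment> \<open>A positive count yields a tuple whose hull contains \<open>c\<close>; this puts
    \<open>c\<close> on the hyperplane and so keeps its two components at distance at least
    \<open>l\<close>.\<close>
  have "0 < r choose (2 * CARD('n))"
    using r(2) by simp
  then have "{A. A \<subseteq> F \<and> card A = 2 * CARD('n) \<and> c \<in> convex hull (x ` A)} \<noteq> {}"
    using c by (metis card.empty not_le)
  then obtain A where A: "A \<subseteq> F" "c \<in> convex hull (x ` A)"
    by blast
  have "convex hull (x ` A) \<subseteq> H"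
    using A(1) H by (intro hull_minimal affine_imp_convex) auto
  then have "(- v, v) \<bullet> c = l"
    using A(2) by (auto simp: H_def)
  then have "(snd c - fst c) \<bullet> v = l"
    by (cases c) (simp add: inner_diff_right inner_commute[of _ v])
  then have "l \<le> dist (snd c) (fst c)"
    using norm_cauchy_schwarz[of "snd c - fst c" v] v by (simp add: dist_norm)
  also have "\<dots> \<le> diameter {fst c, snd c}"
    by (intro diameter_bounded_bound) auto
  finally have "l \<le> diameter {fst c, snd c}" .
  moreover have "{fst c, snd c} \<subseteq> convex hull (\<Union>A)" if A: "A \<subseteq> F" "c \<in> convex hull (x ` A)" for A
  proof -
    have sub: "fst ` x ` A \<subseteq> \<Union>A" "snd ` x ` A \<subseteq> \<Union>A"
      using pq(1,2) A(1) by (fastforce simp: x_def)+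
    \<comment> \<open>Hulls commute with the linear maps \<open>fst\<close> and \<open>snd\<close>,
      so capturing the pair captures both end points.\<close>
    have "fst c \<in> convex hull (fst ` x ` A)" "snd c \<in> convex hull (snd ` x ` A)"
      using A(2) by (auto simp: linear_fst linear_snd simp flip: convex_hull_linear_image)
    then show ?thesis
      using subsetD[OF hull_mono[OF sub(1)]] subsetD[OF hull_mono[OF sub(2)]] by simp
  qed
  then have "card {A. A \<subseteq> F \<and> card A = 2 * CARD('n) \<and> c \<in> convex hull (x ` A)}
      \<le> card {A. A \<subseteq> F \<and> card A = 2 * CARD('n) \<and> {fst c, snd c} \<subseteq> convex hull (\<Union>A)}"
    using \<open>finite F\<close> by (intro card_mono) auto
  ultimately show ?thesis
    using c by (intro exI[of _ "{fst c, snd c}"]) simp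
qed

section \<open>Binomial estimates for large and small families\<close>

text \<open>For large families: \<open>m\<close> is the size of a class holding at least 1 /
  \<open>M\<close> of the \<open>n\<close> members, and \<open>m div D\<close> the number of
  Tverberg classes it supports. The bound compares \<open>(r / k) ^ k\<close> from below with
  \<open>n ^ k\<close> from above.\<close>

lemma binomial_div_ge:
  fixes n m M D k :: nat
  assumes "n \<le> m * M" "M > 0" "D > 0" "k > 0" "k * D * M \<le> n"
  shows "k \<le> m div D" and "(1 / (2 * D * k * M)) ^ k * (n choose k) \<le> real (m div D choose k)"
proof -
  have "k * D * M \<le> m * M"
    using assms by linarith
  then show km: "k \<le> m div D"
    using assms by (simp add: less_eq_div_iff_mult_less_eq)
  define r where "r = m div D"
  have "r > 0"
    using km assms by (simp add: r_def)
  \<comment> \<open>Since \<open>r\<close> is positive, the remainder is below \<open>D * r\<close>;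
    the factor 2 in the bound absorbs the rounding.\<close>
  have "m = D * r + m mod D" "m mod D < D"
    using assms by (simp_all add: r_def)
  moreover have "D \<le> D * r"
    using \<open>r > 0\<close> by simp
  ultimately have "m \<le> 2 * D * r"
    by linarith
  then have "n \<le> 2 * D * r * M"
    using assms(1) mult_le_mono1[of m "2 * D * r" M] by linarith
  then have "real n \<le> 2 * real D * real r * real M"
    by (metis of_nat_le_iff of_nat_mult of_nat_numeral)
  then have "real n / (2 * D * k * M) \<le> real r / k"
    using assms by (simp add: field_simps)
  then have "(real n / (2 * D * k * M)) ^ k \<le> (real r / k) ^ k"
    by (intro power_mono) auto
  also have "\<dots> \<le> real (r choose k)"
    using km by (intro binomial_ge_n_over_k_pow_k) (simp add: r_def)
  finally have *: "(real n / (2 * D * k * M)) ^ k \<le> real (r choose k)" .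
  have "1 * 1 \<le> D * M"
    using assms(2,3) by (intro mult_mono) auto
  then have "k * 1 \<le> k * (D * M)"
    by (intro mult_le_mono2) simp
  then have "k \<le> n"
    using assms(5) by (simp only: mult.assoc mult_1_right)
  then have "real (n choose k) \<le> real n ^ k"
    using binomial_le_pow[of k n] by (metis of_nat_le_iff of_nat_power)
  then have "(1 / (2 * D * k * M)) ^ k * (n choose k) \<le> (1 / (2 * D * k * M)) ^ k * real n ^ k"
    by (intro mult_left_mono) auto
  also have "\<dots> = (real n / (2 * D * k * M)) ^ k"
    by (simp add: power_divide)
  finally show "(1 / (2 * D * k * M)) ^ k * (n choose k) \<le> real (m div D choose k)"
    using * by (simp add: r_def)
qed

text \<open>For small families: the right side counts the \<open>k\<close>-subsets through a fixed
  member, a share \<open>k / n\<close> of all. With \<open>L\<close> the denominator on the left,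
  \<open>n\<close> is at most \<open>k * L\<close>, so this share is at least
  \<open>1 / L\<close>.\<close>

lemma binomial_pred_ge:
  fixes n M D k :: nat
  assumes "n > 0" "k > 0" "n < k * D * M"
  shows "(1 / (2 * D * k * M)) ^ k * (n choose k) \<le> real ((n - 1) choose (k - 1))"
proof -
  have pos: "D > 0" "M > 0"
    using assms by (auto intro!: gr0I)
  define L where "L = 2 * real D * k * M"
  have "1 * 1 \<le> D * (k * M)"
    using pos assms by (intro mult_mono) auto
  then have "1 \<le> real (D * (k * M))"
    by (metis mult_1 of_nat_1 of_nat_le_iff)
  then have L: "L \<ge> 1"
    by (simp add: L_def mult.assoc)
  have "real n \<le> real k * (real D * real M)"
    using assms(3) by (metis less_imp_le mult.assoc of_nat_le_iff of_nat_mult)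
  also have "\<dots> \<le> real k * L"
  proof (intro mult_left_mono)
    have "1 * (real D * real M) \<le> (2 * real k) * (real D * real M)"
      using assms(2) by (intro mult_right_mono) auto
    then show "real D * real M \<le> L"
      by (simp add: L_def mult_ac)
  qed simp
  finally have "real n \<le> real k * L" .
  have "(1 / L) ^ k \<le> (1 / L) ^ 1"
    using L assms(2) by (intro power_decreasing) auto
  then have "(1 / L) ^ k * (n choose k) \<le> (1 / L) * (n choose k)"
    by (intro mult_right_mono) auto
  also have "\<dots> \<le> (real k / n) * (n choose k)"
    using L \<open>n > 0\<close> \<open>real n \<le> real k * L\<close>
    by (intro mult_right_mono) (auto simp: field_simps)
  also have "\<dots> = real ((n - 1) choose (k - 1))"
    using times_binomial_minus1_eq[OF assms(2), of n] assms(1)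
    by (simp add: field_simps flip: of_nat_mult)
  finally show ?thesis
    by (simp add: L_def)
qed

lemma card_subsets_containing:
  assumes "finite F" "C \<in> F" "k > 0"
  shows "card {A. A \<subseteq> F \<and> card A = k \<and> C \<in> A} = (card F - 1) choose (k - 1)"
proof -
  have "bij_betw (insert C) {A. A \<subseteq> F - {C} \<and> card A = k - 1} {A. A \<subseteq> F \<and> card A = k \<and> C \<in> A}"
  proof (rule bij_betwI[where g = "\<lambda>A. A - {C}"])
    show "insert C \<in> {A. A \<subseteq> F - {C} \<and> card A = k - 1} \<rightarrow> {A. A \<subseteq> F \<and> card A = k \<and> C \<in> A}"
      using assms by (auto simp: card_insert_if finite_subset)
  qed (use assms in \<open>auto simp: card_Diff_singleton\<close>)
  then show ?thesis
    using bij_betw_same_card n_subsets[of "F - {C}" "k - 1"] assms by fastforce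
qed

section \<open>Selection at a given mesh, and the choice of mesh and constants\<close>

lemma selection_diameter:
  fixes F :: "(real ^ 'n::finite) set set" and \<delta> :: real
  defines "d \<equiv> CARD('n)"
  assumes "finite F" "0 < \<delta>" "\<delta> < 1" "N > 0" and N: "d / \<delta> \<le> (real N)\<^sup>2"
    and F: "\<And>C. C \<in> F \<Longrightarrow> convex C \<and> bounded C \<and> diameter C = 1"
  shows "\<exists>K. bounded K \<and> diameter K \<ge> 1 - \<delta> \<and>
    (1 / (2 * real ((2 * d + 1)\<^sup>2) * real (2 * d) * real (d * (2 * N + 1) ^ (d - 1)))) ^ (2 * d)
        * real (card F choose (2 * d))
      \<le> real (card {A. A \<subseteq> F \<and> card A = 2 * d \<and> K \<subseteq> convex hull (\<Union>A)})"
proof -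
  have "d > 0"
    by (simp add: d_def)
  \<comment> \<open>\<open>D\<close> is the number of points per Tverberg class in the space of
    pairs, of dimension \<open>2 * d\<close>; \<open>M\<close> is the number of direction
    classes.\<close>
  define D where "D = (2 * d + 1)\<^sup>2"
  define M where "M = d * (2 * N + 1) ^ (d - 1)"
  have pos: "D > 0" "M > 0"
    using \<open>d > 0\<close> by (auto simp: D_def M_def)
  let ?l = "(1 / (2 * real D * real (2 * d) * real M)) ^ (2 * d)"
  let ?count = "\<lambda>K. card {A. A \<subseteq> F \<and> card A = 2 * d \<and> K \<subseteq> convex hull (\<Union>A)}"
  have "\<exists>K. bounded K \<and> diameter K \<ge> 1 - \<delta> \<and> ?l * real (card F choose (2 * d)) \<le> real (?count K)"
  proof (cases "F = {}")
    case True
    \<comment> \<open>There is no member to serve as \<open>K\<close>; any bounded set of large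
      diameter will do.\<close>
    have "diameter (cball 0 1 :: (real ^ 'n) set) = 2"
      by simp
    moreover have "card F choose (2 * d) = 0"
      using True \<open>d > 0\<close> by (simp add: binomial_eq_0)
    ultimately show ?thesis
      using \<open>0 < \<delta>\<close>
      by (intro exI[of _ "cball 0 1"]) (simp del: binomial_eq_0_iff)
  next
    case Fne: False
    then have n: "card F > 0"
      using \<open>finite F\<close> by (simp add: card_gt_0_iff)
    show ?thesis
    proof (cases "card F < 2 * d * D * M")
      case True
      \<comment> \<open>Every \<open>2 * d\<close>-subset containing \<open>C\<close> captures
        \<open>K = C\<close>, whose diameter is 1.\<close>
      obtain C where C: "C \<in> F"
        using Fne by blast
      have "?l * real (card F choose (2 * d)) \<le> real ((card F - 1) choose (2 * d - 1))"
        using binomial_pred_ge[OF n _ True] \<open>d > 0\<close> by simp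
      also have "\<dots> = card {A. A \<subseteq> F \<and> card A = 2 * d \<and> C \<in> A}"
        using card_subsets_containing[OF \<open>finite F\<close> C, of "2 * d"] \<open>d > 0\<close> by simp
      also have "\<dots> \<le> ?count C"
      proof -
        have "C \<subseteq> convex hull (\<Union>A)" if "C \<in> A" for A
          using that hull_subset[of "\<Union>A" convex] by blast
        then show ?thesis
          using \<open>finite F\<close> by (intro of_nat_mono card_mono) auto
      qed
      finally show ?thesis
        using F[OF C] \<open>0 < \<delta>\<close> by (intro exI[of _ C]) auto
    next
      case False
      \<comment> \<open>The diameter need not be attained. Half of \<delta> is given up here, the
        other half when projecting to \<open>v\<close>.\<close>
      have "\<exists>p q. p \<in> C \<and> q \<in> C \<and> 1 - \<delta> / 2 < dist p q" if "C \<in> F" for C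
        using diameter_lower_bounded[of C "1 - \<delta> / 2"] F[OF that] \<open>0 < \<delta>\<close> \<open>\<delta> < 1\<close> by auto
      then obtain p q where pq: "\<And>C. C \<in> F \<Longrightarrow> p C \<in> C" "\<And>C. C \<in> F \<Longrightarrow> q C \<in> C"
          "\<And>C. C \<in> F \<Longrightarrow> 1 - \<delta> / 2 < norm (q C - p C)"
        by (metis dist_norm dist_commute)
      have "q C - p C \<noteq> 0" if "C \<in> F" for C
        using pq(3)[OF that] \<open>\<delta> < 1\<close> by auto
      then obtain v F' where v: "norm v = 1" and F': "F' \<subseteq> F" "card F \<le> card F' * M"
        and long: "\<And>C. C \<in> F' \<Longrightarrow>
          (1 - real d / (2 * (real N)\<^sup>2)) * norm (q C - p C) \<le> \<bar>(q C - p C) \<bullet> v\<bar>"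
        using direction_pigeonhole[of F "\<lambda>C. q C - p C" N, folded d_def, folded M_def] \<open>finite F\<close> Fne \<open>N > 0\<close>
        by blast
      have "finite F'"
        using F'(1) \<open>finite F\<close> finite_subset by blast
      define r where "r = card F' div D"
      have r: "2 * d \<le> r" "?l * (card F choose (2 * d)) \<le> real (r choose (2 * d))"
        using binomial_div_ge[OF F'(2) pos(2,1), of "2 * d"] False \<open>d > 0\<close> by (auto simp: r_def)
      have "\<exists>p'\<in>C. \<exists>q'\<in>C. 1 - \<delta> \<le> (q' - p') \<bullet> v" if "C \<in> F'" for C
      proof -
        have "real d \<le> (real N)\<^sup>2 * \<delta>"
          using N \<open>0 < \<delta>\<close> by (simp add: field_simps)
        then have "1 - \<delta> / 2 \<le> 1 - real d / (2 * (real N)\<^sup>2)"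
          using \<open>N > 0\<close> by (simp add: field_simps)
        then have "(1 - \<delta> / 2) * (1 - \<delta> / 2) \<le> (1 - real d / (2 * (real N)\<^sup>2)) * norm (q C - p C)"
          using pq(3)[of C] that F'(1) \<open>\<delta> < 1\<close> by (intro mult_mono) auto
        moreover have "1 - \<delta> \<le> (1 - \<delta> / 2) * (1 - \<delta> / 2)"
          using zero_le_square[of "\<delta> / 2"] by (simp add: algebra_simps)
        ultimately have "1 - \<delta> \<le> \<bar>(q C - p C) \<bullet> v\<bar>"
          using long[OF that] by linarith
        \<comment> \<open>The direction is known only up to sign; swapping the end points corrects
          it.\<close>
        then have "1 - \<delta> \<le> (q C - p C) \<bullet> v \<or> 1 - \<delta> \<le> (p C - q C) \<bullet> v"
          by (auto simp: abs_if inner_diff_left split: if_splits)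
        then show ?thesis
          using pq(1,2) that F'(1) by blast
      qed
      moreover have "r * D \<le> card F'"
        by (simp add: r_def)
      ultimately obtain K where K: "bounded K" "diameter K \<ge> 1 - \<delta>"
          "r choose (2 * d) \<le> card {A. A \<subseteq> F' \<and> card A = 2 * d \<and> K \<subseteq> convex hull (\<Union>A)}"
        using parallel_segments_selection[of F' r v "1 - \<delta>", folded d_def, folded D_def]
          \<open>finite F'\<close> r(1) v F F'(1) \<open>\<delta> < 1\<close> by auto
      have "card {A. A \<subseteq> F' \<and> card A = 2 * d \<and> K \<subseteq> convex hull (\<Union>A)} \<le> ?count K"
        using F'(1) \<open>finite F\<close> by (intro card_mono) auto
      then have "real (r choose (2 * d)) \<le> real (?count K)"
        using K(3) by linarith
      then show ?thesis
        using r(2) K(1,2) by (intro exI[of _ K]) linarith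
    qed
  qed
  then show ?thesis
    unfolding D_def M_def .
qed

text \<open>\<open>N\<close> is \<open>s = sqrt (d / \<delta>)\<close> rounded up, fine enough for
  the directions. As \<open>s\<close> is at least 1, \<open>2 * N + 1\<close> is at most
  \<open>2 * s + 3\<close>, hence at most \<open>5 * s\<close>.\<close>

lemma grid_size:
  fixes \<delta> :: real and d :: nat
  assumes "0 < \<delta>" "\<delta> < 1" "d > 0"
  obtains N :: nat where "N > 0" "d / \<delta> \<le> (real N)\<^sup>2" "(real (2 * N + 1))\<^sup>2 \<le> 25 * d / \<delta>"
proof
  define s where "s = sqrt (d / \<delta>)"
  have "1 \<le> d / \<delta>"
    using assms by (simp add: field_simps)
  then have s: "s \<ge> 1" "s\<^sup>2 = d / \<delta>"
    by (auto simp: s_def)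
  let ?N = "nat \<lceil>s\<rceil>"
  show "?N > 0"
    using s by linarith
  have "s \<le> real ?N"
    by linarith
  then have "s\<^sup>2 \<le> (real ?N)\<^sup>2"
    using s by (intro power_mono) auto
  then show "d / \<delta> \<le> (real ?N)\<^sup>2"
    using s by simp
  have "real (2 * ?N + 1) \<le> 5 * s"
    using s(1) by linarith
  then have "(real (2 * ?N + 1))\<^sup>2 \<le> (5 * s)\<^sup>2"
    by (intro power_mono) auto
  then show "(real (2 * ?N + 1))\<^sup>2 \<le> 25 * d / \<delta>"
    using s by (simp add: power_mult_distrib)
qed

text \<open>Source of the exponent: the squared number of direction classes is at most a constant
  times \<delta> to the power \<open>- (d - 1)\<close>, and it is raised to the power
  \<open>d\<close>. \<open>L\<close> collects the factors free of \<delta>.\<close>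

lemma inverse_class_count_ge:
  fixes \<delta> L :: real and d N :: nat
  assumes "0 < \<delta>" "d > 0" "L > 0" and N: "(real (2 * N + 1))\<^sup>2 \<le> 25 * d / \<delta>"
  shows "1 / (L ^ (2 * d) * ((real d)\<^sup>2 * (25 * d) ^ (d - 1)) ^ d) * \<delta> ^ (d * (d - 1))
    \<le> (1 / (L * real (d * (2 * N + 1) ^ (d - 1)))) ^ (2 * d)"
proof -
  define M where "M = real (d * (2 * N + 1) ^ (d - 1))"
  have "M > 0"
    using \<open>d > 0\<close> by (simp add: M_def del: of_nat_Suc of_nat_add)
  have "M\<^sup>2 = (real d)\<^sup>2 * ((real (2 * N + 1))\<^sup>2) ^ (d - 1)"
    by (simp add: M_def power_mult_distrib power_mult[symmetric] mult.commute)
  also have "\<dots> \<le> (real d)\<^sup>2 * (25 * d / \<delta>) ^ (d - 1)"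
    using N by (intro mult_left_mono power_mono) auto
  finally have "(M\<^sup>2) ^ d \<le> ((real d)\<^sup>2 * (25 * d / \<delta>) ^ (d - 1)) ^ d"
    by (intro power_mono) auto
  also have "\<dots> = ((real d)\<^sup>2 * (25 * d) ^ (d - 1)) ^ d / \<delta> ^ (d * (d - 1))"
    by (simp add: power_divide power_mult[symmetric] mult.commute)
  finally have "M ^ (2 * d) * \<delta> ^ (d * (d - 1)) \<le> ((real d)\<^sup>2 * (25 * d) ^ (d - 1)) ^ d"
    using \<open>0 < \<delta>\<close> by (simp add: power_mult[of M] pos_le_divide_eq)
  then have "L ^ (2 * d) * (M ^ (2 * d) * \<delta> ^ (d * (d - 1)))
      \<le> L ^ (2 * d) * ((real d)\<^sup>2 * (25 * d) ^ (d - 1)) ^ d"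
    using \<open>L > 0\<close> by (intro mult_left_mono) auto
  then have "\<delta> ^ (d * (d - 1)) * (L * M) ^ (2 * d) \<le> L ^ (2 * d) * ((real d)\<^sup>2 * (25 * d) ^ (d - 1)) ^ d"
    by (simp add: power_mult_distrib mult_ac)
  moreover have "(L * M) ^ (2 * d) > 0" "L ^ (2 * d) * ((real d)\<^sup>2 * (25 * d) ^ (d - 1)) ^ d > 0"
    using \<open>M > 0\<close> \<open>L > 0\<close> \<open>d > 0\<close> by auto
  ultimately have "\<delta> ^ (d * (d - 1)) / (L ^ (2 * d) * ((real d)\<^sup>2 * (25 * d) ^ (d - 1)) ^ d)
      \<le> 1 / (L * M) ^ (2 * d)"
    by (simp only: divide_le_eq le_divide_eq times_divide_eq_left if_True mult_1)
  then show ?thesis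
    by (simp add: M_def power_one_over)
qed

text \<open>The dimension is fixed by the type \<open>'n\<close>, so \<open>lam\<close> takes only
  \<delta>, and \<open>a\<close> and \<open>\<delta>0\<close> depend on the dimension alone.
  Boundedness accompanies \<open>diameter\<close> because a real supremum is meaningful only for
  bounded sets.\<close>

theorem theorem4p3:
  shows "\<exists>lam :: real \<Rightarrow> real.
    (\<forall>\<delta>. 0 < \<delta> \<and> \<delta> < 1 \<longrightarrow>
       lam \<delta> > 0 \<and>
       (\<forall>F :: (real ^ 'n::finite) set set.
          finite F \<and> (\<forall>C\<in>F. convex C \<and> bounded C \<and> diameter C = 1) \<longrightarrow>
          (\<exists>K. bounded K \<and> diameter K \<ge> 1 - \<delta> \<and>
             real (card {A. A \<subseteq> F \<and> card A = 2 * CARD('n) \<and> K \<subseteq> convex hull (\<Union>A)})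
               \<ge> lam \<delta> * real (card F choose (2 * CARD('n)))))) \<and>
    (\<exists>a>0. \<exists>\<delta>0>0. \<forall>\<delta>. 0 < \<delta> \<and> \<delta> < \<delta>0 \<longrightarrow>
       lam \<delta> \<ge> a * \<delta> ^ (CARD('n) * (CARD('n) - 1)))"
proof -
  define d where "d = CARD('n)"
  have "d > 0"
    by (simp add: d_def)
  define L where "L = 2 * real ((2 * d + 1)\<^sup>2) * real (2 * d)"
  have "L > 0"
    using \<open>d > 0\<close> by (simp add: L_def del: of_nat_Suc of_nat_add)
  define a where "a = 1 / (L ^ (2 * d) * ((real d)\<^sup>2 * (25 * d) ^ (d - 1)) ^ d)"
  have "a > 0"
    using \<open>d > 0\<close> \<open>L > 0\<close> by (simp add: a_def)
  have main: "\<exists>K. bounded K \<and> diameter K \<ge> 1 - \<delta> \<and>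
      a * \<delta> ^ (d * (d - 1)) * real (card F choose (2 * d))
        \<le> real (card {A. A \<subseteq> F \<and> card A = 2 * d \<and> K \<subseteq> convex hull (\<Union>A)})"
    if \<delta>: "0 < \<delta>" "\<delta> < 1" and F: "finite F" "\<forall>C\<in>F. convex C \<and> bounded C \<and> diameter C = 1"
    for \<delta> and F :: "(real ^ 'n) set set"
  proof -
    obtain N where N: "N > 0" "d / \<delta> \<le> (real N)\<^sup>2" "(real (2 * N + 1))\<^sup>2 \<le> 25 * d / \<delta>"
      using grid_size[OF \<delta> \<open>d > 0\<close>] .
    define b where "b = (1 / (L * real (d * (2 * N + 1) ^ (d - 1)))) ^ (2 * d)"
    have "\<exists>K. bounded K \<and> diameter K \<ge> 1 - \<delta> \<and> b * real (card F choose (2 * d))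
        \<le> real (card {A. A \<subseteq> F \<and> card A = 2 * d \<and> K \<subseteq> convex hull (\<Union>A)})"
      using selection_diameter[of F \<delta> N, folded d_def, folded L_def, folded b_def] \<delta> F N by auto
    moreover have "a * \<delta> ^ (d * (d - 1)) \<le> b"
      unfolding a_def b_def
      using inverse_class_count_ge[OF \<delta>(1) \<open>d > 0\<close> \<open>L > 0\<close> N(3)] .
    then have "a * \<delta> ^ (d * (d - 1)) * real (card F choose (2 * d)) \<le> b * real (card F choose (2 * d))"
      by (rule mult_right_mono) simp
    ultimately show ?thesis
      by (meson order_trans)
  qed
  show ?thesis
    unfolding d_def[symmetric]
  proof (intro exI[of _ "\<lambda>\<delta>. a * \<delta> ^ (d * (d - 1))"] conjI allI impI)
    fix \<delta> :: real assume "0 < \<delta> \<and> \<delta> < 1"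
    then show "a * \<delta> ^ (d * (d - 1)) > 0"
      using \<open>a > 0\<close> by simp
  next
    fix \<delta> :: real and F :: "(real ^ 'n) set set"
    assume "0 < \<delta> \<and> \<delta> < 1" "finite F \<and> (\<forall>C\<in>F. convex C \<and> bounded C \<and> diameter C = 1)"
    then show "\<exists>K. bounded K \<and> diameter K \<ge> 1 - \<delta> \<and>
        real (card {A. A \<subseteq> F \<and> card A = 2 * d \<and> K \<subseteq> convex hull (\<Union>A)})
          \<ge> a * \<delta> ^ (d * (d - 1)) * real (card F choose (2 * d))"
      using main by blast
  next
    \<comment> \<open>\<open>lam\<close> was chosen equal to the lower bound, so \<open>a\<close>
      itself is the constant and the threshold can be 1.\<close>
    show "\<exists>a'>0. \<exists>\<delta>0>0. \<forall>\<delta>. 0 < \<delta> \<and> \<delta> < \<delta>0 \<longrightarrow>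
        a * \<delta> ^ (d * (d - 1)) \<ge> a' * \<delta> ^ (d * (d - 1))"
      using \<open>a > 0\<close> by (intro exI[of _ a] exI[of _ "1::real"] conjI) auto
  qed
qed

end
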